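(* Let $p>1$, $s\in(0,1)$, and let $\Omega\subset\mathbb{R}^N$ be a bounded domain with $C^{1,1}$ boundary. Let $g\in W_0^{s,p}(\Omega)^*\cap L^1(\Omega)$ and let $u\in W_0^{s,p}(\Omega)$ be a weak solution of $$(-\Delta)_p^su=g(x)\ \text{in }\Omega,\qquad u=0\ \text{in }\mathbb{R}^N\setminus\Omega.$$ Then $$\int_{\mathbb{R}^{2N}}\frac{J_{|u|}(x,y)(\psi(x)-\psi(y))}{|x-y|^{N+sp}}\,dx\,dy\le\int_\Omega|g|\psi\,dx$$ for all $\psi\in W_0^{s,p}(\Omega)\cap L^\infty(\Omega)$ with $\psi\ge0$, where $J_w(x,y)=|w(x)-w(y)|^{p-2}(w(x)-w(y))$.
   Context: Function space: $[u]_{s,p}=\left(\int_{\mathbb{R}^{2N}}\frac{|u(x)-u(y)|^p}{|x-y|^{N+sp}}\,dx\,dy\right)^{1/p}$, $W^{s,p}(\mathbb{R}^N)=\{u\in L^p(\mathbb{R}^N):[u]_{s,p}<\infty\}$, and $W_0^{s,p}(\Omega)=\{u\in W^{s,p}(\mathbb{R}^N): u=0 \text{ a.e. in }\mathbb{R}^N\setminus\Omega\}$ with norm $\|u\|_{W_0^{s,p}(\Omega)}=[u]_{s,p}$; $W_0^{s,p}(\Omega)^*$ is its dual. For a function $g$ on $\Omega$, $g\in W_0^{s,p}(\Omega)^*$ means that for every $v\in W_0^{s,p}(\Omega)$, $gv\in L^1(\Omega)$ and $|\int_\Omega gv\,dx|\le C\|v\|_{W_0^{s,p}(\Omega)}$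 with $C$ independent of $v$. $J_w(x,y)$ is read as $0$ when $w(x)=w(y)$. Operator: $\langle(-\Delta)_p^s u,v\rangle=\int_{\mathbb{R}^{2N}}\frac{J_u(x,y)(v(x)-v(y))}{|x-y|^{N+sp}}\,dx\,dy$ for $u,v\in W_0^{s,p}(\Omega)$. Weak solution: $u\in W_0^{s,p}(\Omega)$ with $\langle(-\Delta)_p^su,v\rangle=\int_\Omega gv\,dx$ for all $v\in W_0^{s,p}(\Omega)$, $v\ge0$. *)

theory Defs
  imports "HOL-Analysis.Analysis"
begin

text \<open>
  The space \<open>\<real>\<^sup>N\<close> is a type of class \<^class>\<open>euclidean_space\<close>, with \<open>N = DIM('a)\<close>, and
  \<open>\<real>\<^sup>2\<^sup>N\<close> is \<open>'a \<times> 'a\<close> with Lebesgue measure.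
  Elements of the function spaces are represented by functions, not by classes modulo null sets.
\<close>

text \<open>
  The boundary is locally, in suitable orthonormal coordinates, the graph of a function of the
  remaining \<open>N - 1\<close> coordinates that is differentiable with Lipschitz gradient \<open>G\<close>.
  The unit vector \<open>e\<close> is the vertical direction, and a function on the hyperplane orthogonal
  to \<open>e\<close> is encoded as a function on the whole space that is constant in the direction \<open>e\<close>.
\<close>

definition C11_boundary :: "'a::euclidean_space set \<Rightarrow> bool" where
  "C11_boundary \<Omega> \<longleftrightarrow>
     (\<forall>x0 \<in> frontier \<Omega>. \<exists>r > 0. \<exists>e \<gamma> G L.
        norm e = 1 \<and>
        (\<forall>x t. \<gamma> (x + t *\<^sub>R e) = \<gamma> x) \<and>
        (\<forall>x. (\<gamma> has_derivative (\<lambda>h. G x \<bullet> h)) (at x)) \<and>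
        L-lipschitz_on UNIV (G :: 'a \<Rightarrow> 'a) \<and>
        \<Omega> \<inter> ball x0 r = {x \<in> ball x0 r. (\<gamma> :: 'a \<Rightarrow> real) x < x \<bullet> e})"

definition bounded_C11_domain :: "'a::euclidean_space set \<Rightarrow> bool" where
  "bounded_C11_domain \<Omega> \<longleftrightarrow>
     \<Omega> \<noteq> {} \<and> open \<Omega> \<and> connected \<Omega> \<and> bounded \<Omega> \<and> C11_boundary \<Omega>"

text \<open>
  At \<open>x = y\<close> the kernels below have denominator \<open>0 powr _ = 0\<close> and hence value \<open>0\<close>;
  the diagonal is a null set.
\<close>

definition gagliardo_energy :: "real \<Rightarrow> real \<Rightarrow> ('a::euclidean_space \<Rightarrow> real) \<Rightarrow> ennreal" where
  "gagliardo_energy s p u =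
     (\<integral>\<^sup>+ (x, y). ennreal (\<bar>u x - u y\<bar> powr p / norm (x - y) powr (real DIM('a) + s * p)) \<partial>lebesgue)"

text \<open>
  The \<open>1/p\<close>-th power is taken in the reals, so \<open>gagliardo_seminorm\<close> is meaningful only if the
  energy is finite; finiteness of the seminorm is therefore expressed through the energy.
\<close>

definition gagliardo_seminorm :: "real \<Rightarrow> real \<Rightarrow> ('a::euclidean_space \<Rightarrow> real) \<Rightarrow> real" where
  "gagliardo_seminorm s p u = enn2real (gagliardo_energy s p u) powr (1 / p)"

definition Wsp :: "real \<Rightarrow> real \<Rightarrow> ('a::euclidean_space \<Rightarrow> real) set" where
  "Wsp s p = {u. u \<in> borel_measurable lebesgue \<and>
                 integrable lebesgue (\<lambda>x. \<bar>u x\<bar> powr p) \<and>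
                 gagliardo_energy s p u < \<infinity>}"

definition Wsp0 :: "real \<Rightarrow> real \<Rightarrow> 'a::euclidean_space set \<Rightarrow> ('a \<Rightarrow> real) set" where
  "Wsp0 s p \<Omega> = {u \<in> Wsp s p. AE x in lebesgue. x \<notin> \<Omega> \<longrightarrow> u x = 0}"

definition Wsp0_dual :: "real \<Rightarrow> real \<Rightarrow> 'a::euclidean_space set \<Rightarrow> ('a \<Rightarrow> real) set" where
  "Wsp0_dual s p \<Omega> =
     {g. (\<forall>v \<in> Wsp0 s p \<Omega>. set_integrable lebesgue \<Omega> (\<lambda>x. g x * v x)) \<and>
         (\<exists>C. \<forall>v \<in> Wsp0 s p \<Omega>.
            \<bar>LINT x:\<Omega>|lebesgue. g x * v x\<bar> \<le> C * gagliardo_seminorm s p v)}"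

definition L1 :: "'a::euclidean_space set \<Rightarrow> ('a \<Rightarrow> real) set" where
  "L1 \<Omega> = {f. set_integrable lebesgue \<Omega> f}"

definition Linf :: "'a::euclidean_space set \<Rightarrow> ('a \<Rightarrow> real) set" where
  "Linf \<Omega> = {f. set_borel_measurable lebesgue \<Omega> f \<and>
                (\<exists>C. AE x in lebesgue. x \<in> \<Omega> \<longrightarrow> \<bar>f x\<bar> \<le> C)}"

text \<open>For \<open>w x = w y\<close> the value is \<open>0\<close>, also when \<open>p < 2\<close>.\<close>

definition J :: "real \<Rightarrow> ('a \<Rightarrow> real) \<Rightarrow> 'a \<Rightarrow> 'a \<Rightarrow> real" where
  "J p w x y = \<bar>w x - w y\<bar> powr (p - 2) * (w x - w y)"

definition frac_p_laplacian ::
    "real \<Rightarrow> real \<Rightarrow> ('a::euclidean_space \<Rightarrow> real) \<Rightarrow> ('a \<Rightarrow> real) \<Rightarrow> real" where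
  "frac_p_laplacian s p u v =
     (\<integral> (x, y). J p u x y * (v x - v y) / norm (x - y) powr (real DIM('a) + s * p) \<partial>lebesgue)"

definition weak_solution ::
    "real \<Rightarrow> real \<Rightarrow> 'a::euclidean_space set \<Rightarrow> ('a \<Rightarrow> real) \<Rightarrow> ('a \<Rightarrow> real) \<Rightarrow> bool" where
  "weak_solution s p \<Omega> g u \<longleftrightarrow>
     u \<in> Wsp0 s p \<Omega> \<and>
     (\<forall>v \<in> Wsp0 s p \<Omega>. (AE x in lebesgue. 0 \<le> v x) \<longrightarrow>
        frac_p_laplacian s p u v = (LINT x:\<Omega>|lebesgue. g x * v x))"

end

theory Submission
  imports Defs
begin

text \<open>
  Let \<open>T\<^sub>n(t) = max (-1) (min 1 (n t))\<close>, a nondecreasing Lipschitz approximation of the sign. Since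
  \<open>\<psi>\<close> is bounded, \<open>\<psi> T\<^sub>n(u)\<^sup>+\<close> and \<open>\<psi> T\<^sub>n(u)\<^sup>-\<close> are admissible nonnegative test functions, and
  subtracting the two equations bounds the energy pairing of \<open>u\<close> with \<open>\<psi> T\<^sub>n(u)\<close> by
  \<open>\<integral> \<bar>g\<bar> \<psi>\<close>. By monotonicity of \<open>T\<^sub>n\<close> its integrand is at least
  \<open>- \<bar>J\<^sub>u(x,y)\<bar> \<bar>\<psi>(x) - \<psi>(y)\<bar>\<close> times the kernel, which is integrable and independent of \<open>n\<close>;
  in the limit, \<open>J\<^sub>u(x,y) (\<psi>(x) sgn u(x) - \<psi>(y) sgn u(y)) \<ge> J\<^bsub>\<bar>u\<bar>\<^esub>(x,y) (\<psi>(x) - \<psi>(y))\<close>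
  pointwise. Passing to the limit in the negative part of the difference of the two integrands
  needs only dominated convergence.
\<close>

section \<open>Lebesgue null sets and measurability under the two projections\<close>

lemma null_sets_lborel_vimage_fst_snd:
  fixes N :: "'a::euclidean_space set"
  assumes "N \<in> null_sets lborel"
  shows "fst -` N \<in> null_sets (lborel :: ('a \<times> 'b::euclidean_space) measure)"
    and "snd -` N \<in> null_sets (lborel :: ('b \<times> 'a) measure)"
proof -
  have 1: "fst -` N = N \<times> (UNIV :: 'b set)" and 2: "snd -` N = (UNIV :: 'b set) \<times> N"
    by auto
  have "N \<times> (UNIV :: 'b set) \<in> null_sets (lborel \<Otimes>\<^sub>M lborel)"
    using assms lborel.times_in_null_sets1[of N lborel "UNIV :: 'b set"] by auto
  then show "fst -` N \<in> null_sets (lborel :: ('a \<times> 'b) measure)"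
    by (simp add: 1 lborel_prod)
  have "(UNIV :: 'b set) \<times> N \<in> null_sets (lborel \<Otimes>\<^sub>M lborel)"
    using assms lborel.times_in_null_sets2[of N lborel "UNIV :: 'b set"] by auto
  then show "snd -` N \<in> null_sets (lborel :: ('b \<times> 'a) measure)"
    by (simp add: 2 lborel_prod)
qed

text \<open>The exceptional set lies in a Borel null set, and both cylinders over it are null. This
  carries the one-variable facts about \<psi>, its sign and its bound, to the pairs over which the
  energy is integrated.\<close>

lemma AE_lebesgue_fst_snd:
  fixes P :: "'a::euclidean_space \<Rightarrow> bool"
  assumes "AE x in lebesgue. P x"
  shows "AE z in (lebesgue :: ('a \<times> 'a) measure). P (fst z) \<and> P (snd z)"
proof -
  obtain N where N: "N \<in> null_sets lborel" "{x. \<not> P x} \<subseteq> N"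
    using assms[unfolded AE_completion_iff] by (auto simp: eventually_ae_filter)
  have "fst -` N \<union> snd -` N \<in> null_sets (lborel :: ('a \<times> 'a) measure)"
    using null_sets_lborel_vimage_fst_snd[OF N(1)] by blast
  then have "AE z in (lborel :: ('a \<times> 'a) measure). P (fst z) \<and> P (snd z)"
    by (rule AE_I') (use N(2) in auto)
  then show ?thesis
    by (rule AE_completion)
qed

text \<open>Lebesgue measure on the product is the completion of the Borel product, so continuity of
  the projections handles Borel sets only. Preimages of null sets under the projections are null,
  and this extends measurability to the completions.\<close>

lemma borel_measurable_lebesgue_fst_snd:
  fixes u :: "'a::euclidean_space \<Rightarrow> real"
  assumes "u \<in> borel_measurable lebesgue"
  shows "(\<lambda>z. u (fst z)) \<in> borel_measurable (lebesgue :: ('a \<times> 'b::euclidean_space) measure)"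
    and "(\<lambda>z. u (snd z)) \<in> borel_measurable (lebesgue :: ('b \<times> 'a) measure)"
proof -
  have fst: "fst \<in> (lebesgue :: ('a \<times> 'b) measure) \<rightarrow>\<^sub>M lborel"
    by (rule measurable_completion) (simp add: borel_measurable_continuous_onI continuous_on_fst)
  have snd: "snd \<in> (lebesgue :: ('b \<times> 'a) measure) \<rightarrow>\<^sub>M lborel"
    by (rule measurable_completion) (simp add: borel_measurable_continuous_onI continuous_on_snd)
  have "fst \<in> (lebesgue :: ('a \<times> 'b) measure) \<rightarrow>\<^sub>M lebesgue"
  proof (rule completion.measurable_completion2[OF fst], rule subsetI)
    fix N :: "'a set"
    assume N: "N \<in> null_sets lborel"
    then show "N \<in> null_sets (distr (lebesgue :: ('a \<times> 'b) measure) lborel fst)"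
      using null_sets_completionI[OF null_sets_lborel_vimage_fst_snd(1)[OF N]] null_setsD2[OF N]
      unfolding null_sets_distr_iff[OF fst] by simp
  qed
  then show "(\<lambda>z. u (fst z)) \<in> borel_measurable (lebesgue :: ('a \<times> 'b) measure)"
    using assms by (rule measurable_compose)
  have "snd \<in> (lebesgue :: ('b \<times> 'a) measure) \<rightarrow>\<^sub>M lebesgue"
  proof (rule completion.measurable_completion2[OF snd], rule subsetI)
    fix N :: "'a set"
    assume N: "N \<in> null_sets lborel"
    then show "N \<in> null_sets (distr (lebesgue :: ('b \<times> 'a) measure) lborel snd)"
      using null_sets_completionI[OF null_sets_lborel_vimage_fst_snd(2)[OF N]] null_setsD2[OF N]
      unfolding null_sets_distr_iff[OF snd] by simp
  qed
  then show "(\<lambda>z. u (snd z)) \<in> borel_measurable (lebesgue :: ('b \<times> 'a) measure)"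
    using assms by (rule measurable_compose)
qed

section \<open>The Gagliardo kernel, the energy pairing and products as test functions\<close>

abbreviation gagliardo_weight :: "real \<Rightarrow> 'a::euclidean_space \<times> 'a \<Rightarrow> real" where
  "gagliardo_weight q z \<equiv> norm (fst z - snd z) powr q"

lemma borel_measurable_gagliardo_weight [measurable]:
  "gagliardo_weight q \<in> borel_measurable (lebesgue :: ('a::euclidean_space \<times> 'a) measure)"
proof (rule measurable_completion)
  have "(\<lambda>z::'a \<times> 'a. norm (fst z - snd z)) \<in> borel_measurable lborel"
    by (simp add: borel_measurable_continuous_onI continuous_intros)
  then show "gagliardo_weight q \<in> borel_measurable (lborel :: ('a \<times> 'a) measure)"
    by (rule powr_real_measurable) simp
qed

lemma Wsp_measurable: "u \<in> Wsp s p \<Longrightarrow> u \<in> borel_measurable lebesgue"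
  by (simp add: Wsp_def)

lemma borel_measurable_J:
  fixes u :: "'a::euclidean_space \<Rightarrow> real"
  assumes "u \<in> borel_measurable lebesgue"
  shows "(\<lambda>z. J p u (fst z) (snd z)) \<in> borel_measurable (lebesgue :: ('a \<times> 'a) measure)"
proof -
  note [measurable] = borel_measurable_lebesgue_fst_snd[OF assms]
  show ?thesis unfolding J_def by measurable
qed

lemma gagliardo_energy_eq:
  fixes u :: "'a::euclidean_space \<Rightarrow> real"
  shows "gagliardo_energy s p u = (\<integral>\<^sup>+ z.
    ennreal (\<bar>u (fst z) - u (snd z)\<bar> powr p / gagliardo_weight (real DIM('a) + s * p) z)
    \<partial>(lebesgue :: ('a \<times> 'a) measure))"
  unfolding gagliardo_energy_def case_prod_beta' ..

lemma Wsp_integrable_energy: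
  fixes u :: "'a::euclidean_space \<Rightarrow> real"
  assumes "u \<in> Wsp s p"
  shows "integrable lebesgue (\<lambda>z::'a \<times> 'a.
    \<bar>u (fst z) - u (snd z)\<bar> powr p / gagliardo_weight (real DIM('a) + s * p) z)"
proof -
  note [measurable] = borel_measurable_lebesgue_fst_snd[OF Wsp_measurable[OF assms]]
  show ?thesis
  proof (rule integrableI_nonneg)
    show "(\<lambda>z::'a \<times> 'a. \<bar>u (fst z) - u (snd z)\<bar> powr p / gagliardo_weight (real DIM('a) + s * p) z)
      \<in> borel_measurable lebesgue" by measurable
    show "(\<integral>\<^sup>+ z. ennreal (\<bar>u (fst z) - u (snd z)\<bar> powr p
      / gagliardo_weight (real DIM('a) + s * p) z) \<partial>(lebesgue :: ('a \<times> 'a) measure)) < \<infinity>"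
      using assms unfolding Wsp_def gagliardo_energy_eq[symmetric] by blast
  qed simp
qed

lemma abs_powr_mult_self: "\<bar>\<bar>t\<bar> powr (p - 2) * t\<bar> = \<bar>t::real\<bar> powr (p - 1)"
\<comment> \<open>At \<open>t = 0\<close> both sides vanish because \<open>0 powr a = 0\<close> for
  every exponent, also a negative one.\<close>
proof (cases "t = 0")
  case False
  then have "\<bar>t\<bar> powr (p - 2) * \<bar>t\<bar> = \<bar>t\<bar> powr (p - 2) * \<bar>t\<bar> powr 1" by simp
  also have "\<dots> = \<bar>t\<bar> powr (p - 1)" by (subst powr_add[symmetric]) simp
  finally show ?thesis by (simp add: abs_mult)
qed simp

lemma abs_J: "\<bar>J p w x y\<bar> = \<bar>w x - w y\<bar> powr (p - 1)"
  by (simp add: J_def abs_powr_mult_self)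

text \<open>A crude Young inequality: the product is at most the \<open>p\<close>-th power of the
  larger of \<open>a\<close> and \<open>b\<close>. The constant is irrelevant, since it serves
  integrability only.\<close>

lemma powr_mult_le_powr_add:
  fixes a b :: real
  assumes "0 \<le> a" "0 \<le> b" "1 < p"
  shows "a powr (p - 1) * b \<le> a powr p + b powr p"
proof -
  have *: "m powr (p - 1) * m = m powr p" if "0 \<le> m" for m :: real
  proof (cases "m = 0")
    case False
    then have "m powr (p - 1) * m = m powr (p - 1) * m powr 1" using that by simp
    also have "\<dots> = m powr p" by (subst powr_add[symmetric]) simp
    finally show ?thesis .
  qed simp
  show ?thesis
  proof (cases "a \<le> b")
    case True
    then have "a powr (p - 1) * b \<le> b powr (p - 1) * b"
      using assms by (intro mult_right_mono powr_mono2) auto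
    then show ?thesis using *[of b] assms by (simp add: add_increasing)
  next
    case False
    then have "a powr (p - 1) * b \<le> a powr (p - 1) * a"
      using assms by (intro mult_left_mono) auto
    then show ?thesis using *[of a] assms by (simp add: add_increasing2)
  qed
qed

lemma powr_add_le:
  fixes a b :: real
  assumes "0 \<le> a" "0 \<le> b" "0 < p"
  shows "(a + b) powr p \<le> 2 powr p * (a powr p + b powr p)"
proof -
  have "(a + b) powr p \<le> (2 * max a b) powr p"
    using assms by (intro powr_mono2) auto
  also have "\<dots> = 2 powr p * max a b powr p"
    using assms by (simp add: powr_mult)
  also have "\<dots> \<le> 2 powr p * (a powr p + b powr p)"
    by (intro mult_left_mono) (auto simp: max_def)
  finally show ?thesis .
qed

text \<open>As \<bar>J\<bar> is the power \<open>p - 1\<close> of the difference of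
  \<open>u\<close>, the crude Young inequality dominates the integrand by the sum of the two energy
  densities. Hence the integral defining \<open>frac_p_laplacian\<close> is a genuine one and may be
  split linearly in \<open>v\<close>.\<close>

lemma integrable_J_pairing:
  fixes u v :: "'a::euclidean_space \<Rightarrow> real"
  assumes u: "u \<in> Wsp s p" and v: "v \<in> Wsp s p" and p: "1 < p"
  shows "integrable lebesgue (\<lambda>z::'a \<times> 'a. J p u (fst z) (snd z) * (v (fst z) - v (snd z))
    / gagliardo_weight (real DIM('a) + s * p) z)"
proof (rule Bochner_Integration.integrable_bound)
  note [measurable] = borel_measurable_J[OF Wsp_measurable[OF u]]
    borel_measurable_lebesgue_fst_snd[OF Wsp_measurable[OF v]]
  show "(\<lambda>z::'a \<times> 'a. J p u (fst z) (snd z) * (v (fst z) - v (snd z))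
    / gagliardo_weight (real DIM('a) + s * p) z) \<in> borel_measurable lebesgue" by measurable
  show "integrable lebesgue (\<lambda>z::'a \<times> 'a.
      \<bar>u (fst z) - u (snd z)\<bar> powr p / gagliardo_weight (real DIM('a) + s * p) z
    + \<bar>v (fst z) - v (snd z)\<bar> powr p / gagliardo_weight (real DIM('a) + s * p) z)"
    using u v by (intro Bochner_Integration.integrable_add Wsp_integrable_energy)
  have "norm (J p u x y * (v x - v y) / K)
    \<le> norm (\<bar>u x - u y\<bar> powr p / K + \<bar>v x - v y\<bar> powr p / K)" if "0 \<le> K" for x y and K :: real
    using powr_mult_le_powr_add[OF _ _ p, of "\<bar>u x - u y\<bar>" "\<bar>v x - v y\<bar>"] that
    by (simp add: abs_mult abs_J add_divide_distrib[symmetric] divide_right_mono)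
  then show "AE z::'a \<times> 'a in lebesgue.
    norm (J p u (fst z) (snd z) * (v (fst z) - v (snd z)) / gagliardo_weight (real DIM('a) + s * p) z)
    \<le> norm (\<bar>u (fst z) - u (snd z)\<bar> powr p / gagliardo_weight (real DIM('a) + s * p) z
    + \<bar>v (fst z) - v (snd z)\<bar> powr p / gagliardo_weight (real DIM('a) + s * p) z)"
    by simp
qed

text \<open>The difference of the product splits into (\<psi>(x) - \<psi>(y)) T(u(x)) and \<psi>(y)
  (T(u(x)) - T(u(y))). The first part is controlled by the energy of \<psi>, the second by
  \<open>C * L\<close> times the difference of \<open>u\<close>; this is where boundedness of \<psi>
  enters.\<close>

lemma Wsp0_mult_lipschitz:
  fixes u \<psi> :: "'a::euclidean_space \<Rightarrow> real" and T :: "real \<Rightarrow> real"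
  assumes u: "u \<in> Wsp s p" and \<psi>: "\<psi> \<in> Wsp0 s p \<Omega>" and p: "1 < p"
    and C: "AE x in lebesgue. \<bar>\<psi> x\<bar> \<le> C"
    and T: "\<And>t. \<bar>T t\<bar> \<le> 1" and L: "L-lipschitz_on UNIV T"
  shows "(\<lambda>x. \<psi> x * T (u x)) \<in> Wsp0 s p \<Omega>"
proof -
  have \<psi>W: "\<psi> \<in> Wsp s p" and \<psi>0: "AE x in lebesgue. x \<notin> \<Omega> \<longrightarrow> \<psi> x = 0"
    using \<psi> by (auto simp: Wsp0_def)
  note [measurable] = Wsp_measurable[OF u] Wsp_measurable[OF \<psi>W]
  have [measurable]: "T \<in> borel_measurable borel"
    using lipschitz_on_continuous_on[OF L] by (rule borel_measurable_continuous_onI)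
  let ?v = "\<lambda>x. \<psi> x * T (u x)"
  have meas [measurable]: "?v \<in> borel_measurable lebesgue" by measurable
  have T': "\<bar>\<psi> x * T (u x)\<bar> \<le> \<bar>\<psi> x\<bar>" for x
    using mult_left_le[OF T, of "\<bar>\<psi> x\<bar>"] by (simp add: abs_mult)
  have Lp: "integrable lebesgue (\<lambda>x. \<bar>?v x\<bar> powr p)"
  proof (rule Bochner_Integration.integrable_bound)
    show "integrable lebesgue (\<lambda>x. \<bar>\<psi> x\<bar> powr p)" using \<psi>W by (simp add: Wsp_def)
    show "AE x in lebesgue. norm (\<bar>?v x\<bar> powr p) \<le> norm (\<bar>\<psi> x\<bar> powr p)"
      using p T' by (intro always_eventually allI) (simp add: powr_mono2)
  qed measurable
  let ?q = "real DIM('a) + s * p"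
  \<comment> \<open>The factor \<open>2 powr p\<close> comes from \<open>powr_add_le\<close>; the
    maximum absorbs the coefficients 1 and \<open>(C * L) powr p\<close> of the two energy
    terms.\<close>
  define M where "M = 2 powr p * max 1 ((C * L) powr p)"
  have bound: "\<bar>\<psi> x * T (u x) - \<psi> y * T (u y)\<bar> powr p
    \<le> M * (\<bar>\<psi> x - \<psi> y\<bar> powr p + \<bar>u x - u y\<bar> powr p)" if "\<bar>\<psi> y\<bar> \<le> C" for x y
  proof -
    have "\<bar>T (u x) - T (u y)\<bar> \<le> L * \<bar>u x - u y\<bar>"
      using lipschitz_onD[OF L, of "u x" "u y"] by (simp add: dist_real_def)
    moreover have CL: "0 \<le> C * L"
      using lipschitz_on_nonneg[OF L] that by (intro mult_nonneg_nonneg) auto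
    ultimately have "\<bar>\<psi> y\<bar> * \<bar>T (u x) - T (u y)\<bar> \<le> C * (L * \<bar>u x - u y\<bar>)"
      using that lipschitz_on_nonneg[OF L] by (intro mult_mono) auto
    moreover have "\<bar>\<psi> x - \<psi> y\<bar> * \<bar>T (u x)\<bar> \<le> \<bar>\<psi> x - \<psi> y\<bar>"
      using T by (intro mult_left_le) auto
    moreover have "\<psi> x * T (u x) - \<psi> y * T (u y)
      = (\<psi> x - \<psi> y) * T (u x) + \<psi> y * (T (u x) - T (u y))"
      by (simp add: algebra_simps)
    ultimately have "\<bar>\<psi> x * T (u x) - \<psi> y * T (u y)\<bar>
      \<le> \<bar>\<psi> x - \<psi> y\<bar> + C * L * \<bar>u x - u y\<bar>"
      using abs_triangle_ineq[of "(\<psi> x - \<psi> y) * T (u x)" "\<psi> y * (T (u x) - T (u y))"]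
        lipschitz_on_nonneg[OF L] abs_ge_zero[of "\<psi> y"] that
      by (simp add: abs_mult mult.assoc)
    then have "\<bar>\<psi> x * T (u x) - \<psi> y * T (u y)\<bar> powr p
      \<le> (\<bar>\<psi> x - \<psi> y\<bar> + C * L * \<bar>u x - u y\<bar>) powr p"
      using p by (intro powr_mono2) auto
    also have "\<dots> \<le> 2 powr p * (\<bar>\<psi> x - \<psi> y\<bar> powr p + (C * L * \<bar>u x - u y\<bar>) powr p)"
      using p CL by (intro powr_add_le) auto
    also have "\<dots> = 2 powr p * (1 * \<bar>\<psi> x - \<psi> y\<bar> powr p + (C * L) powr p * \<bar>u x - u y\<bar> powr p)"
      using CL by (subst powr_mult) auto
    also have "\<dots> \<le> 2 powr p * (max 1 ((C * L) powr p) * \<bar>\<psi> x - \<psi> y\<bar> powr p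
        + max 1 ((C * L) powr p) * \<bar>u x - u y\<bar> powr p)"
      by (intro mult_left_mono add_mono mult_right_mono) auto
    finally show ?thesis by (simp add: M_def algebra_simps)
  qed
  have "integrable lebesgue (\<lambda>z::'a \<times> 'a. \<bar>?v (fst z) - ?v (snd z)\<bar> powr p / gagliardo_weight ?q z)"
  proof (rule Bochner_Integration.integrable_bound)
    note [measurable] = borel_measurable_lebesgue_fst_snd[OF meas]
    show "(\<lambda>z::'a \<times> 'a. \<bar>?v (fst z) - ?v (snd z)\<bar> powr p / gagliardo_weight ?q z) \<in> borel_measurable lebesgue"
      by measurable
    show "integrable lebesgue (\<lambda>z::'a \<times> 'a. M * (\<bar>\<psi> (fst z) - \<psi> (snd z)\<bar> powr p / gagliardo_weight ?q z
      + \<bar>u (fst z) - u (snd z)\<bar> powr p / gagliardo_weight ?q z))"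
      using u \<psi>W by (intro integrable_mult_right Bochner_Integration.integrable_add Wsp_integrable_energy)
    show "AE z::'a \<times> 'a in lebesgue. norm (\<bar>?v (fst z) - ?v (snd z)\<bar> powr p / gagliardo_weight ?q z)
      \<le> norm (M * (\<bar>\<psi> (fst z) - \<psi> (snd z)\<bar> powr p / gagliardo_weight ?q z
      + \<bar>u (fst z) - u (snd z)\<bar> powr p / gagliardo_weight ?q z))"
      using AE_lebesgue_fst_snd[OF C]
    proof eventually_elim
      case (elim z)
      have "\<bar>?v (fst z) - ?v (snd z)\<bar> powr p / gagliardo_weight ?q z
        \<le> M * (\<bar>\<psi> (fst z) - \<psi> (snd z)\<bar> powr p + \<bar>u (fst z) - u (snd z)\<bar> powr p) / gagliardo_weight ?q z"
        using elim by (intro divide_right_mono bound) auto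
      also have "\<dots> = M * (\<bar>\<psi> (fst z) - \<psi> (snd z)\<bar> powr p / gagliardo_weight ?q z
        + \<bar>u (fst z) - u (snd z)\<bar> powr p / gagliardo_weight ?q z)"
        by (simp only: add_divide_distrib distrib_left times_divide_eq_right)
      finally show ?case by simp
    qed
  qed
  then have "gagliardo_energy s p ?v < \<infinity>"
    unfolding gagliardo_energy_eq integrable_iff_bounded by simp
  then show ?thesis
    using \<psi>0 Lp meas by (auto simp: Wsp0_def Wsp_def elim: eventually_mono)
qed

section \<open>Approximations of the sign and pointwise inequalities\<close>

definition cutoff :: "nat \<Rightarrow> real \<Rightarrow> real" where
  "cutoff n t = max 0 (min 1 (real n * t))"

lemma cutoff_bounds: "0 \<le> cutoff n t" "cutoff n t \<le> 1"
  by (auto simp: cutoff_def)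

lemma cutoff_lipschitz: "(real n)-lipschitz_on UNIV (cutoff n)"
proof (rule lipschitz_onI)
  fix x y :: real
  have "\<bar>cutoff n x - cutoff n y\<bar> \<le> \<bar>real n * x - real n * y\<bar>"
    by (simp add: cutoff_def)
  also have "\<dots> = real n * \<bar>x - y\<bar>"
    by (simp flip: right_diff_distrib add: abs_mult)
  finally show "dist (cutoff n x) (cutoff n y) \<le> real n * dist x y"
    by (simp add: dist_real_def)
qed simp

text \<open>This is the function \<open>T\<^sub>n\<close> = \<open>max (-1) (min 1 (n * t))\<close>,
  written as the difference of its positive and negative parts because weak solutions are tested
  with nonnegative functions only.\<close>

definition sgn_approx :: "nat \<Rightarrow> real \<Rightarrow> real" where
  "sgn_approx n t = cutoff n t - cutoff n (- t)"

lemma sgn_approx_abs_le: "\<bar>sgn_approx n t\<bar> \<le> 1"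
  using cutoff_bounds[of n t] cutoff_bounds[of n "- t"] by (auto simp: sgn_approx_def)

lemma sgn_approx_mono: "a \<le> b \<Longrightarrow> sgn_approx n a \<le> sgn_approx n b"
  using mult_left_mono[of a b "real n"] by (simp add: sgn_approx_def cutoff_def)

text \<open>The sequence is eventually constant: from \<open>n\<close> at least
  \<open>1 / \<bar>t\<bar>\<close> on if \<open>t\<close> is nonzero, and always if \<open>t\<close>
  is zero.\<close>

lemma tendsto_sgn_approx: "(\<lambda>n. sgn_approx n t) \<longlonglongrightarrow> sgn t"
proof (rule tendsto_eventually)
  show "\<forall>\<^sub>F n in sequentially. sgn_approx n t = sgn t"
  proof (cases "t = 0")
    case False
    have "\<forall>\<^sub>F n in sequentially. 1 / \<bar>t\<bar> \<le> real n"
      using filterlim_real_sequentially by (simp add: filterlim_at_top)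
    then show ?thesis
    proof eventually_elim
      case (elim n)
      then have "1 \<le> real n * \<bar>t\<bar>" using False by (simp add: field_simps)
      then show ?case using False
        by (cases "t > 0") (auto simp: sgn_approx_def cutoff_def)
    qed
  qed (simp add: sgn_approx_def cutoff_def)
qed

text \<open>In the product-rule splitting, the term with factor \<psi>(y) is nonnegative, because J
  has the sign of u(x) - u(y) and \<open>sgn_approx n\<close> is monotone. The other term is bounded
  through \<open>\<bar>sgn_approx n t\<bar> \<le> 1\<close>. The lower bound is free of
  \<open>n\<close>, as domination in the limit requires.\<close>

lemma J_mult_sgn_approx_ge:
  assumes "0 \<le> \<psi> y"
  shows "- (\<bar>J p u x y\<bar> * \<bar>\<psi> x - \<psi> y\<bar>)
    \<le> J p u x y * (\<psi> x * sgn_approx n (u x) - \<psi> y * sgn_approx n (u y))"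
proof -
  have eq: "J p u x y * (\<psi> x * sgn_approx n (u x) - \<psi> y * sgn_approx n (u y))
    = J p u x y * (\<psi> x - \<psi> y) * sgn_approx n (u x)
      + \<psi> y * (J p u x y * (sgn_approx n (u x) - sgn_approx n (u y)))"
    by (simp add: algebra_simps)
  have "0 \<le> J p u x y * (sgn_approx n (u x) - sgn_approx n (u y))"
    using sgn_approx_mono[of "u x" "u y" n] sgn_approx_mono[of "u y" "u x" n]
    by (cases "u x \<le> u y") (auto simp: J_def zero_le_mult_iff mult_le_0_iff)
  then have "0 \<le> \<psi> y * (J p u x y * (sgn_approx n (u x) - sgn_approx n (u y)))"
    using assms by simp
  moreover have "\<bar>J p u x y * (\<psi> x - \<psi> y) * sgn_approx n (u x)\<bar> \<le> \<bar>J p u x y\<bar> * \<bar>\<psi> x - \<psi> y\<bar>"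
    using mult_left_le[OF sgn_approx_abs_le, of "\<bar>J p u x y * (\<psi> x - \<psi> y)\<bar>"]
    by (simp add: abs_mult)
  ultimately show ?thesis unfolding eq by linarith
qed

text \<open>The reverse triangle inequality, raised to the positive power
  \<open>p - 1\<close>.\<close>

lemma abs_J_abs_le:
  assumes "1 < p"
  shows "\<bar>J p (\<lambda>z. \<bar>u z\<bar>) x y\<bar> \<le> \<bar>J p u x y\<bar>"
  unfolding abs_J using assms by (intro powr_mono2) auto

text \<open>If \<open>u\<close> has the same strict sign at both points, the two sides agree. If it
  vanishes at exactly one of them, the right side only drops a nonpositive term. Opposite signs make
  the right side \<bar>J\<bar> (\<psi>(x) + \<psi>(y)), which dominates the left.\<close>

lemma J_abs_le_J_sgn:
  assumes p: "1 < p" and \<psi>: "0 \<le> \<psi> x" "0 \<le> \<psi> y"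
  shows "J p (\<lambda>z. \<bar>u z\<bar>) x y * (\<psi> x - \<psi> y) \<le> J p u x y * (\<psi> x * sgn (u x) - \<psi> y * sgn (u y))"
    (is "?G \<le> ?F")
proof -
  \<comment> \<open>This settles the two cases of opposite signs, where \<open>?F\<close> equals
    this upper bound.\<close>
  have G: "?G \<le> \<bar>J p u x y\<bar> * (\<psi> x + \<psi> y)"
  proof -
    have "?G \<le> \<bar>J p (\<lambda>z. \<bar>u z\<bar>) x y\<bar> * \<bar>\<psi> x - \<psi> y\<bar>"
      by (simp flip: abs_mult)
    also have "\<dots> \<le> \<bar>J p u x y\<bar> * (\<psi> x + \<psi> y)"
      using abs_J_abs_le[OF p] \<psi> by (intro mult_mono) auto
    finally show ?thesis .
  qed
  have nonneg: "0 \<le> J p u x y" if "u y \<le> u x" using that by (simp add: J_def)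
  have nonpos: "J p u x y \<le> 0" if "u x \<le> u y" using that by (simp add: J_def mult_le_0_iff)
  consider "u x > 0" "u y > 0" | "u x < 0" "u y < 0" | "u x = 0" "u y = 0"
    | "u x > 0" "u y = 0" | "u x < 0" "u y = 0" | "u x = 0" "u y > 0" | "u x = 0" "u y < 0"
    | "u x > 0" "u y < 0" | "u x < 0" "u y > 0" by linarith
  then show ?thesis
  proof cases
    case 8 then show ?thesis using G nonneg by simp
  next
    case 9 then show ?thesis using G nonpos by (simp add: algebra_simps)
  qed (use \<psi> in \<open>auto simp: J_def abs_minus_commute algebra_simps mult_le_0_iff zero_le_mult_iff\<close>)
qed

lemma Linf_Wsp0_AE_bounded:
  assumes "\<psi> \<in> Wsp0 s p \<Omega> \<inter> Linf \<Omega>"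
  obtains C where "AE x in lebesgue. \<bar>\<psi> x\<bar> \<le> C"
proof -
  obtain C where "AE x in lebesgue. x \<in> \<Omega> \<longrightarrow> \<bar>\<psi> x\<bar> \<le> C"
    using assms by (auto simp: Linf_def)
  moreover have "AE x in lebesgue. x \<notin> \<Omega> \<longrightarrow> \<psi> x = 0"
    using assms by (auto simp: Wsp0_def)
  \<comment> \<open>The bound from \<open>Linf\<close> concerns \<Omega> only and \<open>C\<close>
    has no prescribed sign; the maximum with 0 also covers the points outside, where \<psi>
    vanishes.\<close>
  ultimately have "AE x in lebesgue. \<bar>\<psi> x\<bar> \<le> max C 0"
    by eventually_elim force
  then show ?thesis by (rule that)
qed

section \<open>Testing the equation and passing to the limit\<close>

theorem proposition2p2:
  fixes p s :: real and \<Omega> :: "'a::euclidean_space set" and g u :: "'a \<Rightarrow> real"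
  assumes "1 < p" and "0 < s" and "s < 1"
    and "bounded_C11_domain \<Omega>"
    and "g \<in> Wsp0_dual s p \<Omega> \<inter> L1 \<Omega>"
    and "weak_solution s p \<Omega> g u"
  shows "\<forall>\<psi> \<in> Wsp0 s p \<Omega> \<inter> Linf \<Omega>. (AE x in lebesgue. 0 \<le> \<psi> x) \<longrightarrow>
           (\<integral> (x, y). J p (\<lambda>z. \<bar>u z\<bar>) x y * (\<psi> x - \<psi> y)
                         / norm (x - y) powr (real DIM('a) + s * p) \<partial>lebesgue)
             \<le> (LINT x:\<Omega>|lebesgue. \<bar>g x\<bar> * \<psi> x)"
proof (intro ballI impI)
  fix \<psi> :: "'a \<Rightarrow> real"
  assume \<psi>: "\<psi> \<in> Wsp0 s p \<Omega> \<inter> Linf \<Omega>" and pos: "AE x in lebesgue. 0 \<le> \<psi> x"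
  then have \<psi>W: "\<psi> \<in> Wsp s p" and \<psi>W0: "\<psi> \<in> Wsp0 s p \<Omega>" by (auto simp: Wsp0_def)
  have uW: "u \<in> Wsp s p" using assms(6) by (auto simp: weak_solution_def Wsp0_def)
  obtain C where C: "AE x in lebesgue. \<bar>\<psi> x\<bar> \<le> C" using Linf_Wsp0_AE_bounded[OF \<psi>] .
  let ?q = "real DIM('a) + s * p"
  let ?T = "\<lambda>n x. \<psi> x * sgn_approx n (u x)"
  define F where "F n z = J p u (fst z) (snd z) * (?T n (fst z) - ?T n (snd z)) / gagliardo_weight ?q z"
    for n :: nat and z :: "'a \<times> 'a"
  define G where "G z = J p (\<lambda>z. \<bar>u z\<bar>) (fst z) (snd z) * (\<psi> (fst z) - \<psi> (snd z)) / gagliardo_weight ?q z"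
    for z :: "'a \<times> 'a"
  define B where "B z = \<bar>J p u (fst z) (snd z) * (\<psi> (fst z) - \<psi> (snd z)) / gagliardo_weight ?q z\<bar>"
    for z :: "'a \<times> 'a"
  have intB: "integrable lebesgue B"
    unfolding B_def by (intro integrable_abs integrable_J_pairing uW \<psi>W assms(1))
  \<comment> \<open>Integrability of \<open>G\<close> follows from this domination, without placing
    \<bar>u\<bar> in the function space.\<close>
  have GB: "\<bar>G z\<bar> \<le> B z" for z
    using abs_J_abs_le[OF assms(1), of u "fst z" "snd z"]
    by (simp add: G_def B_def abs_mult divide_right_mono mult_right_mono)
  have intG: "integrable lebesgue G"
  proof (rule Bochner_Integration.integrable_bound[OF intB])
    have "(\<lambda>z. \<bar>u z\<bar>) \<in> borel_measurable lebesgue" using Wsp_measurable[OF uW] by measurable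
    note [measurable] = borel_measurable_J[OF this]
      borel_measurable_lebesgue_fst_snd[OF Wsp_measurable[OF \<psi>W]]
    show "G \<in> borel_measurable lebesgue" unfolding G_def by measurable
    show "AE z in lebesgue. norm (G z) \<le> norm (B z)"
      using GB by (auto intro!: always_eventually simp: B_def)
  qed
  have dual: "set_integrable lebesgue \<Omega> (\<lambda>x. g x * v x)" if "v \<in> Wsp0 s p \<Omega>" for v
    using assms(5) that by (auto simp: Wsp0_dual_def)
  have intF: "integrable lebesgue (F n)"
    and F_le: "integral\<^sup>L lebesgue (F n) \<le> (LINT x:\<Omega>|lebesgue. \<bar>g x\<bar> * \<psi> x)" for n
  proof -
    \<comment> \<open>The two nonnegative test functions, whose difference is \<psi> times
      \<open>sgn_approx n\<close> of \<open>u\<close>.\<close>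
    define v w where "v = (\<lambda>x. \<psi> x * cutoff n (u x))" and "w = (\<lambda>x. \<psi> x * cutoff n (- u x))"
    have v: "v \<in> Wsp0 s p \<Omega>" unfolding v_def
      using cutoff_bounds by (intro Wsp0_mult_lipschitz[OF uW \<psi>W0 assms(1) C _ cutoff_lipschitz]) auto
    have "(real n)-lipschitz_on UNIV (\<lambda>t. cutoff n (- t))"
      using cutoff_lipschitz[of n] by (auto simp: lipschitz_on_def dist_real_def) (metis abs_minus_commute minus_diff_eq minus_diff_minus)
    then have w: "w \<in> Wsp0 s p \<Omega>" unfolding w_def
      using cutoff_bounds
      by (intro Wsp0_mult_lipschitz[OF uW \<psi>W0 assms(1) C, where T = "\<lambda>t. cutoff n (- t)"]) auto
    have vW: "v \<in> Wsp s p" and wW: "w \<in> Wsp s p" using v w by (auto simp: Wsp0_def)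
    have nonneg: "AE x in lebesgue. 0 \<le> v x" "AE x in lebesgue. 0 \<le> w x"
      using pos cutoff_bounds by (auto simp: v_def w_def elim!: eventually_mono)
    have F_eq: "F n = (\<lambda>z. J p u (fst z) (snd z) * (v (fst z) - v (snd z)) / gagliardo_weight ?q z
      - J p u (fst z) (snd z) * (w (fst z) - w (snd z)) / gagliardo_weight ?q z)"
      by (auto simp: F_def v_def w_def sgn_approx_def algebra_simps add_divide_distrib diff_divide_distrib)
    show "integrable lebesgue (F n)" unfolding F_eq
      by (intro Bochner_Integration.integrable_diff integrable_J_pairing uW vW wW assms(1))
    have "integral\<^sup>L lebesgue (F n) = frac_p_laplacian s p u v - frac_p_laplacian s p u w"
      unfolding F_eq frac_p_laplacian_def case_prod_beta'
      by (intro Bochner_Integration.integral_diff integrable_J_pairing uW vW wW assms(1))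
    also have "frac_p_laplacian s p u v = (LINT x:\<Omega>|lebesgue. g x * v x)"
      using assms(6) v nonneg(1) by (auto simp: weak_solution_def)
    also have "frac_p_laplacian s p u w = (LINT x:\<Omega>|lebesgue. g x * w x)"
      using assms(6) w nonneg(2) by (auto simp: weak_solution_def)
    also have "(LINT x:\<Omega>|lebesgue. g x * v x) - (LINT x:\<Omega>|lebesgue. g x * w x)
      = (LINT x:\<Omega>|lebesgue. g x * v x - g x * w x)"
      by (intro set_integral_diff(2)[symmetric] dual v w)
    also have "\<dots> \<le> (LINT x:\<Omega>|lebesgue. \<bar>g x\<bar> * \<psi> x)"
      unfolding set_lebesgue_integral_def
    proof (rule integral_mono_AE)
      show "integrable lebesgue (\<lambda>x. indicat_real \<Omega> x *\<^sub>R (g x * v x - g x * w x))"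
        using set_integral_diff(1)[OF dual[OF v] dual[OF w]] by (simp add: set_integrable_def)
      show "integrable lebesgue (\<lambda>x. indicat_real \<Omega> x *\<^sub>R (\<bar>g x\<bar> * \<psi> x))"
      proof (rule Bochner_Integration.integrable_bound)
        show int: "integrable lebesgue (\<lambda>x. indicat_real \<Omega> x *\<^sub>R (g x * \<psi> x))"
          using dual[OF \<psi>W0] by (simp add: set_integrable_def)
        have [measurable]: "(\<lambda>x. indicat_real \<Omega> x *\<^sub>R (g x * \<psi> x)) \<in> borel_measurable lebesgue"
          using int by (rule borel_measurable_integrable)
        note [measurable] = Wsp_measurable[OF \<psi>W]
        \<comment> \<open>Measurability is inherited from g \<psi>, integrable on \<Omega> by
          duality. Since \<psi> is nonnegative only almost everywhere, the factor
          \<open>sgn (\<psi> x)\<close> is what makes the identity hold at every point.\<close>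
        have "(\<lambda>x. indicat_real \<Omega> x *\<^sub>R (\<bar>g x\<bar> * \<psi> x))
          = (\<lambda>x. \<bar>indicat_real \<Omega> x *\<^sub>R (g x * \<psi> x)\<bar> * sgn (\<psi> x))"
          by (simp add: abs_mult abs_mult_sgn mult.assoc)
        moreover have "(\<lambda>x. \<bar>indicat_real \<Omega> x *\<^sub>R (g x * \<psi> x)\<bar> * sgn (\<psi> x)) \<in> borel_measurable lebesgue"
          by measurable
        ultimately show "(\<lambda>x. indicat_real \<Omega> x *\<^sub>R (\<bar>g x\<bar> * \<psi> x)) \<in> borel_measurable lebesgue"
          by (simp only:)
      qed (simp add: abs_mult)
      show "AE x in lebesgue. indicat_real \<Omega> x *\<^sub>R (g x * v x - g x * w x)
        \<le> indicat_real \<Omega> x *\<^sub>R (\<bar>g x\<bar> * \<psi> x)"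
        using pos
      proof eventually_elim
        case (elim x)
        have "g x * v x - g x * w x = g x * \<psi> x * sgn_approx n (u x)"
          by (simp add: v_def w_def sgn_approx_def algebra_simps)
        also have "\<dots> \<le> \<bar>g x * \<psi> x\<bar> * \<bar>sgn_approx n (u x)\<bar>"
          by (simp flip: abs_mult)
        also have "\<dots> \<le> \<bar>g x\<bar> * \<psi> x"
          using mult_left_le[OF sgn_approx_abs_le, of "\<bar>g x * \<psi> x\<bar>"] elim by (simp add: abs_mult)
        finally show ?case by (auto intro: mult_left_mono)
      qed
    qed
    finally show "integral\<^sup>L lebesgue (F n) \<le> (LINT x:\<Omega>|lebesgue. \<bar>g x\<bar> * \<psi> x)" .
  qed
  \<comment> \<open>The available upper estimates of \<open>F n\<close> grow with the Lipschitz
    constant \<open>n\<close>, so only the part of \<open>F n - G\<close> below 0 is followed. It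
    tends to 0 because the pointwise limit of \<open>F n\<close> is at least
    \<open>G\<close>.\<close>
  have lim: "(\<lambda>n. \<integral>z. min (F n z - G z) 0 \<partial>lebesgue) \<longlonglongrightarrow> (\<integral>z. 0 \<partial>(lebesgue :: ('a \<times> 'a) measure))"
  proof (rule integral_dominated_convergence)
    \<comment> \<open>\<open>F n\<close> is at least \<open>- B\<close> and \<open>G\<close> at most
      \<open>B\<close>, hence the factor 2.\<close>
    show "integrable lebesgue (\<lambda>z. 2 * B z)" using intB by simp
    show "(\<lambda>z. min (F n z - G z) 0) \<in> borel_measurable lebesgue" for n
      using intF[of n] intG by (auto dest!: borel_measurable_integrable)
    show "AE z in lebesgue. (\<lambda>n. min (F n z - G z) 0) \<longlonglongrightarrow> 0"
      using AE_lebesgue_fst_snd[OF pos]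
    proof eventually_elim
      case (elim z)
      let ?l = "J p u (fst z) (snd z)
        * (\<psi> (fst z) * sgn (u (fst z)) - \<psi> (snd z) * sgn (u (snd z))) / gagliardo_weight ?q z"
      \<comment> \<open>The weight vanishes on the diagonal; rewriting the quotient as a product
        with a constant inverse gives the limit there too.\<close>
      have "(\<lambda>n. F n z) \<longlonglongrightarrow> ?l"
        unfolding F_def divide_inverse by (intro tendsto_intros tendsto_sgn_approx)
      then have "(\<lambda>n. min (F n z - G z) 0) \<longlonglongrightarrow> min (?l - G z) 0"
        by (intro tendsto_intros)
      moreover have "G z \<le> ?l"
        unfolding G_def using elim by (intro divide_right_mono J_abs_le_J_sgn assms(1)) auto
      ultimately show ?case by simp
    qed
    show "AE z in lebesgue. norm (min (F n z - G z) 0) \<le> 2 * B z" for n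
      using AE_lebesgue_fst_snd[OF pos]
    proof eventually_elim
      case (elim z)
      have "- (\<bar>J p u (fst z) (snd z)\<bar> * \<bar>\<psi> (fst z) - \<psi> (snd z)\<bar>) / gagliardo_weight ?q z \<le> F n z"
        unfolding F_def using elim by (intro divide_right_mono J_mult_sgn_approx_ge) auto
      then have "- B z \<le> F n z" by (simp add: B_def abs_mult)
      with GB[of z] show ?case by (auto simp: min_def)
    qed
  qed simp
  \<comment> \<open>The sum \<open>G z + min (F n z - G z) 0\<close> is the minimum of
    \<open>F n z\<close> and \<open>G z\<close>, hence at most \<open>F n z\<close>.\<close>
  have "integral\<^sup>L lebesgue G + (\<integral>z. min (F n z - G z) 0 \<partial>lebesgue)
    \<le> (LINT x:\<Omega>|lebesgue. \<bar>g x\<bar> * \<psi> x)" for n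
  proof -
    have intH: "integrable lebesgue (\<lambda>z. min (F n z - G z) 0)"
      using intF intG by (intro integrable_min Bochner_Integration.integrable_diff) auto
    have "integral\<^sup>L lebesgue G + (\<integral>z. min (F n z - G z) 0 \<partial>lebesgue)
      = (\<integral>z. G z + min (F n z - G z) 0 \<partial>lebesgue)"
      using intG intH by simp
    also have "\<dots> \<le> integral\<^sup>L lebesgue (F n)"
      using intG intH intF by (intro integral_mono) auto
    also note F_le
    finally show ?thesis .
  qed
  then have "integral\<^sup>L lebesgue G + (\<integral>z. 0 \<partial>(lebesgue :: ('a \<times> 'a) measure)) \<le> (LINT x:\<Omega>|lebesgue. \<bar>g x\<bar> * \<psi> x)"
    by (intro tendsto_upperbound[OF tendsto_add[OF tendsto_const lim]]) auto
  then show "(\<integral> (x, y). J p (\<lambda>z. \<bar>u z\<bar>) x y * (\<psi> x - \<psi> y)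
      / norm (x - y) powr (real DIM('a) + s * p) \<partial>lebesgue) \<le> (LINT x:\<Omega>|lebesgue. \<bar>g x\<bar> * \<psi> x)"
    unfolding G_def case_prod_beta' by simp
qed

end
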